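(* In the setting described in the context, assume there is a constant $\tilde\alpha$ such that $\tilde s_j(\pi)\le\tilde\alpha n/\log p$ for every permutation $\pi$ and every $j$. Then for all $t>0$, $$\mathbb P\Big(\exists\pi:\ \sum_{j=1}^p\Big(\frac{\|\tilde\epsilon_j(\pi)\|_n^2-|\tilde\omega^0_j(\pi)|^2}{|\tilde\omega^0_j(\pi)|^2}\Big)^2\ge8\Big(\frac{pt+(1+8\tilde\alpha)\tilde s(\pi)\log p+2p\log p}{n}\Big)+8\Big(\frac{4p(t^2+\log^2p)}{n^2}\Big)\Big)\le2\exp[-t].$$
   Context: Setting: $n,p$ positive integers, $p\ge2$; $\Sigma_0$ a nonsingular $p\times p$ covariance matrix; $X=(X_1,\dots,X_p)$ an $n\times p$ random matrix with i.i.d. $\mathcal N_p(0,\Sigma_0)$ rows; $\|X\beta\|^2:=\beta^T\Sigma_0\beta$ for $\beta\in\mathbb R^p$; $\|v\|_n^2:=v^Tv/n$ for $v\in\mathbb R^n$; $X_j=Xe_j$. For a permutation $\pi=(\pi_1,\dots,\pi_p)$ of $\{1,\dots,p\}$: $\tilde\beta^0_{\pi_k}(\pi)$ is the vector supported on $\{\pi_{k+1},\dots,\pi_p\}$ such that $X\tilde\beta^0_{\pi_k}(\pi)$ is the orthogonal projection of $X_{\pi_k}$ onto span$\{X_{\pi_{k+1}},\dots,X_{\pi_p}\}$ w.r.t. the inner product $\beta^T\Sigma_0\gamma$; $\tilde s_j(\pi)$ is the number of nonzero entries of $\tilde\beta^0_j(\pi)$, $\tilde s(\pi):=\sum_j\tilde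 s_j(\pi)$; $\tilde\epsilon_j(\pi):=X_j-X\tilde\beta^0_j(\pi)\in\mathbb R^n$; $|\tilde\omega^0_j(\pi)|^2:=\|X_j-X\tilde\beta^0_j(\pi)\|^2$. *)

theory Defs
  imports "HOL-Probability.Probability"
begin

text \<open>Columns are indexed by the finite type 'p (so p = CARD('p)), rows by the
finite type 'n (so n = CARD('n)).  A data matrix is an element of real^'p^'n,
row i being X $ i.\<close>

definition mvn_density :: "real^'p^'p \<Rightarrow> real^'p \<Rightarrow> real" where
  "mvn_density S x =
     exp (- (x \<bullet> (matrix_inv S *v x)) / 2) / sqrt ((2 * pi) ^ CARD('p) * det S)"

definition mvn :: "real^'p^'p \<Rightarrow> (real^'p) measure" where
  "mvn S = density lborel (\<lambda>x. ennreal (mvn_density S x))"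

definition nonsingular_cov :: "real^'p^'p \<Rightarrow> bool" where
  "nonsingular_cov S \<longleftrightarrow> transpose S = S \<and> (\<forall>x. 0 \<le> x \<bullet> (S *v x)) \<and> invertible S"

text \<open>A permutation (pi_1,...,pi_p) of the variables: position k (0-based, k < p)
holds the variable pi k.\<close>
definition is_perm :: "(nat \<Rightarrow> 'p::finite) \<Rightarrow> bool" where
  "is_perm \<pi> \<longleftrightarrow> bij_betw \<pi> {..<CARD('p)} UNIV"

definition perm_pos :: "(nat \<Rightarrow> 'p::finite) \<Rightarrow> 'p \<Rightarrow> nat" where
  "perm_pos \<pi> j = the_inv_into {..<CARD('p)} \<pi> j"

definition later_vars :: "(nat \<Rightarrow> 'p::finite) \<Rightarrow> 'p \<Rightarrow> 'p set" where
  "later_vars \<pi> j = \<pi> ` {Suc (perm_pos \<pi> j)..<CARD('p)}"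

definition sig_inner :: "real^'p^'p \<Rightarrow> real^'p \<Rightarrow> real^'p \<Rightarrow> real" where
  "sig_inner S b g = b \<bullet> (S *v g)"

text \<open>tilde beta^0_j(pi): supported on later_vars pi j, with X beta the orthogonal
projection of X_j = X e_j onto span{X_k : k in later_vars pi j} w.r.t. sig_inner.\<close>
definition beta_tilde :: "real^'p^'p \<Rightarrow> (nat \<Rightarrow> 'p::finite) \<Rightarrow> 'p \<Rightarrow> real^'p" where
  "beta_tilde S \<pi> j = (THE b. (\<forall>k. k \<notin> later_vars \<pi> j \<longrightarrow> b $ k = 0) \<and>
      (\<forall>k\<in>later_vars \<pi> j. sig_inner S (axis j 1 - b) (axis k 1) = 0))"

definition s_tilde_j :: "real^'p^'p \<Rightarrow> (nat \<Rightarrow> 'p::finite) \<Rightarrow> 'p \<Rightarrow> nat" where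
  "s_tilde_j S \<pi> j = card {k. beta_tilde S \<pi> j $ k \<noteq> 0}"

definition s_tilde :: "real^'p^'p \<Rightarrow> (nat \<Rightarrow> 'p::finite) \<Rightarrow> nat" where
  "s_tilde S \<pi> = (\<Sum>j\<in>UNIV. s_tilde_j S \<pi> j)"

definition eps_tilde :: "real^'p^'p \<Rightarrow> real^'p^'n \<Rightarrow> (nat \<Rightarrow> 'p::finite) \<Rightarrow> 'p \<Rightarrow> real^'n" where
  "eps_tilde S X \<pi> j = X *v (axis j 1 - beta_tilde S \<pi> j)"

definition omega_sq :: "real^'p^'p \<Rightarrow> (nat \<Rightarrow> 'p::finite) \<Rightarrow> 'p \<Rightarrow> real" where
  "omega_sq S \<pi> j = sig_inner S (axis j 1 - beta_tilde S \<pi> j) (axis j 1 - beta_tilde S \<pi> j)"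

definition norm_n_sq :: "real^'n::finite \<Rightarrow> real" where
  "norm_n_sq v = (v \<bullet> v) / real CARD('n)"

end

theory Submission
  imports Defs
begin

text \<open>
For fixed regression coefficients the normalised residual sum of squares is a mean of squares of
independent standard Gaussians, so it concentrates with the Laurent--Massart exponents. The
vector \<open>beta_tilde S \<pi> j\<close> is determined by \<open>j\<close> and its own support \<open>K\<close>, since projecting on the
columns in \<open>K\<close> alone gives the same result. Hence a union bound over the pairs \<open>(j, K)\<close> covers all
permutations, with exponent \<open>t + (5/3 + card K) ln p\<close>.
\<close>

text \<open>The total threshold is a sum over \<open>j\<close> of individual shares. Reaching it
  forces some single residual to reach its own share, so only marginal laws enter and no dependence
  between residuals or between permutations has to be controlled. A residual whose support has
  \<open>s\<close> elements deviates by the order of \<open>sqrt (u / n) + u / n\<close> with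
  \<open>u\<close> about \<open>t + s * ln p\<close>, so its square contains
  \<open>(s * ln p / n)\<^sup>2\<close>. The sparsity bound replaces one of these two factors by
  \<open>alpha\<close>; this is the origin of \<open>8 * alpha\<close> in the threshold. The factor
  2 in \<open>2 * exp (- t)\<close> counts the upper and the lower tail; the sum of all weights in
  the union bound is at most \<open>exp (- t)\<close>.\<close>

section \<open>Linear substitutions in Lebesgue integrals\<close>

lemma nn_integral_lborel_add:
  fixes f :: "'a::euclidean_space \<Rightarrow> ennreal"
  assumes [measurable]: "f \<in> borel_measurable borel"
  shows "(\<integral>\<^sup>+x. f (x + c) \<partial>lborel) = (\<integral>\<^sup>+x. f x \<partial>lborel)"
proof -
  have "(\<integral>\<^sup>+x. f x \<partial>lborel) = (\<integral>\<^sup>+x. f x \<partial>distr lborel borel ((+) c))"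
    by (simp only: lborel_distr_plus)
  also have "\<dots> = (\<integral>\<^sup>+x. f (c + x) \<partial>lborel)"
    by (rule nn_integral_distr) auto
  finally show ?thesis by (simp add: add.commute)
qed

lemma nn_integral_lborel_uminus:
  fixes f :: "'a::euclidean_space \<Rightarrow> ennreal"
  assumes [measurable]: "f \<in> borel_measurable borel"
  shows "(\<integral>\<^sup>+x. f (- x) \<partial>lborel) = (\<integral>\<^sup>+x. f x \<partial>lborel)"
proof -
  have "(lborel :: 'a measure) = distr lborel borel uminus"
    using lborel_affine[of "-1" "0 :: 'a"] by (simp add: density_1)
  then have "(\<integral>\<^sup>+x. f x \<partial>lborel) = (\<integral>\<^sup>+x. f x \<partial>distr lborel borel uminus)"
    by simp
  also have "\<dots> = (\<integral>\<^sup>+x. f (- x) \<partial>lborel)"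
    by (rule nn_integral_distr) auto
  finally show ?thesis by simp
qed

text \<open>Uniqueness of the translation-invariant measure, cross-multiplied so that no integral
  has to be finite or nonzero. The double integral of \<open>g (T y) * f (x + T y)\<close> splits
  when \<open>x\<close> is integrated first; shifting \<open>y\<close> by \<open>inv T x\<close>
  gives \<open>g (T y - x) * f (T y)\<close>, which splits the other way.\<close>

lemma nn_integral_linear_proportional:
  fixes T :: "'a::euclidean_space \<Rightarrow> 'a" and f g :: "'a \<Rightarrow> ennreal"
  assumes T: "linear T" "bij T"
    and [measurable]: "f \<in> borel_measurable borel" "g \<in> borel_measurable borel"
  shows "(\<integral>\<^sup>+x. f (T x) \<partial>lborel) * (\<integral>\<^sup>+x. g x \<partial>lborel)
       = (\<integral>\<^sup>+x. g (T x) \<partial>lborel) * (\<integral>\<^sup>+x. f x \<partial>lborel)"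
proof -
  interpret linear T by fact
  have [measurable]: "T \<in> borel_measurable borel"
    using T(1) by (intro borel_measurable_continuous_onI linear_continuous_on)
      (simp add: linear_conv_bounded_linear)
  have T_inv: "T (inv T x) = x" for x
    using T(2) by (simp add: bij_is_surj surj_f_inv_f)
  have "(\<integral>\<^sup>+y. g (T y) \<partial>lborel) * (\<integral>\<^sup>+x. f x \<partial>lborel)
      = (\<integral>\<^sup>+y. g (T y) * (\<integral>\<^sup>+x. f x \<partial>lborel) \<partial>lborel)"
    by (simp add: nn_integral_multc)
  also have "\<dots> = (\<integral>\<^sup>+y. (\<integral>\<^sup>+x. g (T y) * f (x + T y) \<partial>lborel) \<partial>lborel)"
    by (simp add: nn_integral_cmult nn_integral_lborel_add)
  also have "\<dots> = (\<integral>\<^sup>+x. (\<integral>\<^sup>+y. g (T y) * f (x + T y) \<partial>lborel) \<partial>lborel)"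
    by (rule lborel_pair.Fubini') simp
  also have "\<dots> = (\<integral>\<^sup>+x. (\<integral>\<^sup>+y. g (T y - x) * f (T y) \<partial>lborel) \<partial>lborel)"
  proof (rule nn_integral_cong)
    fix x
    show "(\<integral>\<^sup>+y. g (T y) * f (x + T y) \<partial>lborel) = (\<integral>\<^sup>+y. g (T y - x) * f (T y) \<partial>lborel)"
      using nn_integral_lborel_add[of "\<lambda>y. g (T y - x) * f (T y)" "inv T x"]
      by (simp add: add T_inv add.commute)
  qed
  also have "\<dots> = (\<integral>\<^sup>+y. (\<integral>\<^sup>+x. g (T y - x) * f (T y) \<partial>lborel) \<partial>lborel)"
    by (rule lborel_pair.Fubini') simp
  also have "\<dots> = (\<integral>\<^sup>+y. (\<integral>\<^sup>+x. g x \<partial>lborel) * f (T y) \<partial>lborel)"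
  proof (rule nn_integral_cong)
    fix y
    have "(\<integral>\<^sup>+x. g (T y - x) \<partial>lborel) = (\<integral>\<^sup>+x. g (T y + x) \<partial>lborel)"
      using nn_integral_lborel_uminus[of "\<lambda>x. g (T y + x)"] by simp
    also have "\<dots> = (\<integral>\<^sup>+x. g x \<partial>lborel)"
      using nn_integral_lborel_add[of g "T y"] by (simp add: add.commute)
    finally show "(\<integral>\<^sup>+x. g (T y - x) * f (T y) \<partial>lborel) = (\<integral>\<^sup>+x. g x \<partial>lborel) * f (T y)"
      by (simp add: nn_integral_multc)
  qed
  also have "\<dots> = (\<integral>\<^sup>+x. f (T x) \<partial>lborel) * (\<integral>\<^sup>+x. g x \<partial>lborel)"
    by (simp add: nn_integral_cmult mult.commute)
  finally show ?thesis by simp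
qed

lemma nn_integral_lborel_scale_coordinate:
  fixes f :: "'a::euclidean_space \<Rightarrow> ennreal"
  assumes i: "i \<in> Basis" and c: "1 + c \<noteq> 0"
    and [measurable]: "f \<in> borel_measurable borel"
  shows "ennreal \<bar>1 + c\<bar> * (\<integral>\<^sup>+x. f (x + (c * (x \<bullet> i)) *\<^sub>R i) \<partial>lborel) = (\<integral>\<^sup>+x. f x \<partial>lborel)"
proof -
  define d where "d j = (if j = i then 1 + c else 1)" for j
  define D where "D x = 0 + (\<Sum>j\<in>Basis. (d j * (x \<bullet> j)) *\<^sub>R j)" for x :: 'a
  have D: "D x = x + (c * (x \<bullet> i)) *\<^sub>R i" for x
  proof -
    have "D x = (\<Sum>j\<in>Basis. (x \<bullet> j) *\<^sub>R j + (if j = i then (c * (x \<bullet> i)) *\<^sub>R i else 0))"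
      unfolding D_def d_def by (auto intro!: sum.cong simp: algebra_simps)
    also have "\<dots> = x + (c * (x \<bullet> i)) *\<^sub>R i"
      using i by (simp add: sum.distrib euclidean_representation sum.delta)
    finally show ?thesis .
  qed
  have [measurable]: "D \<in> borel_measurable borel" unfolding D_def by measurable
  have "(\<Prod>j\<in>Basis. \<bar>d j\<bar>) = (\<Prod>j\<in>Basis. if j = i then \<bar>1 + c\<bar> else 1)"
    by (intro prod.cong) (auto simp: d_def)
  then have prod: "(\<Prod>j\<in>Basis. \<bar>d j\<bar>) = \<bar>1 + c\<bar>"
    using i by (simp add: prod.delta)
  have "lborel = density (distr lborel borel D) (\<lambda>_. ennreal (\<Prod>j\<in>Basis. \<bar>d j\<bar>))"
    unfolding D_def[abs_def] by (rule lborel_affine_euclidean) (use c in \<open>auto simp: d_def\<close>)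
  then have "(\<integral>\<^sup>+x. f x \<partial>lborel) = (\<integral>\<^sup>+x. f x \<partial>density (distr lborel borel D) (\<lambda>_. ennreal \<bar>1 + c\<bar>))"
    unfolding prod by simp
  also have "\<dots> = ennreal \<bar>1 + c\<bar> * (\<integral>\<^sup>+x. f (D x) \<partial>lborel)"
    by (simp add: nn_integral_density nn_integral_cmult nn_integral_distr)
  finally show ?thesis by (simp add: D)
qed

text \<open>The map is \<open>P \<circ> D \<circ> P\<^sup>-\<^sup>1\<close> with \<open>D\<close> a scaling of one coordinate, and the modulus of \<open>P\<close>
cancels, so no determinant is needed (\<open>measure_linear_image\<close> requires a well-ordered index type).\<close>
lemma nn_integral_lborel_rank_one:
  fixes f :: "'a::euclidean_space \<Rightarrow> ennreal"
  assumes c0: "b \<bullet> w \<noteq> 0" and c1: "1 + b \<bullet> w \<noteq> 0"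
    and f[measurable]: "f \<in> borel_measurable borel"
  shows "ennreal \<bar>1 + b \<bullet> w\<bar> * (\<integral>\<^sup>+x. f (x + (b \<bullet> x) *\<^sub>R w) \<partial>lborel) = (\<integral>\<^sup>+x. f x \<partial>lborel)"
proof -
  have "b \<noteq> 0" using c0 by auto
  then obtain i where i: "i \<in> Basis" "b \<bullet> i \<noteq> 0"
    by (metis euclidean_eqI inner_zero_left)
  define A where "A x = x + (b \<bullet> x) *\<^sub>R w" for x
  \<comment> \<open>\<open>P\<close> maps \<open>i\<close> to \<open>w\<close> and the hyperplane
    orthogonal to \<open>i\<close> into the one orthogonal to \<open>b\<close>. \<open>A\<close>
    fixes the latter and multiplies \<open>w\<close> by \<open>1 + b \<bullet> w\<close>, so in
    these coordinates it is \<open>D\<close>. By \<open>c0\<close>, \<open>w\<close> lies outside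
    that hyperplane, which makes \<open>P\<close> injective.\<close>
  define P where "P x = x - ((b \<bullet> x) / (b \<bullet> i)) *\<^sub>R i + (x \<bullet> i) *\<^sub>R w" for x
  define D where "D x = x + ((b \<bullet> w) * (x \<bullet> i)) *\<^sub>R i" for x
  have ii: "i \<bullet> i = 1" using i by simp
  have bP: "b \<bullet> P x = (x \<bullet> i) * (b \<bullet> w)" for x
    using i by (simp add: P_def inner_simps)
  have AP: "A (P x) = P (D x)" for x
    unfolding A_def bP
    using i by (simp add: P_def D_def inner_simps ii algebra_simps add_divide_distrib)
  have linP: "linear P"
    by (rule linearI) (simp_all add: P_def inner_simps algebra_simps add_divide_distrib)
  have "x = 0" if "P x = 0" for x
  proof -
    have "x \<bullet> i = 0" using bP[of x] that c0 by simp
    then have x: "x = ((b \<bullet> x) / (b \<bullet> i)) *\<^sub>R i" using that by (simp add: P_def)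
    then have "x \<bullet> i = (b \<bullet> x) / (b \<bullet> i)" using ii by (metis inner_scaleR_left mult.right_neutral)
    then have "b \<bullet> x = 0" using \<open>x \<bullet> i = 0\<close> i(2) by simp
    then show "x = 0" using x by simp
  qed
  then have "inj P" using linear_injective_0[OF linP] by auto
  then have bijP: "bij P"
    using linear_injective_imp_surjective[OF linP] by (simp add: bij_def)
  have P[measurable]: "P \<in> borel_measurable borel" and A[measurable]: "A \<in> borel_measurable borel"
    unfolding P_def A_def by measurable
  \<comment> \<open>A test function for cancelling the modulus of \<open>P\<close>: its pullback
    under \<open>P\<close> is the indicator of the unit ball, of positive finite volume.\<close>
  define B where "B = P ` ball 0 (1::real)"
  have "open B" unfolding B_def
    using open_surjective_linear_image[of "ball 0 1" P] linP bijP by (simp add: bij_is_surj)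
  define g where "g = (indicator B :: 'a \<Rightarrow> ennreal)"
  have g[measurable]: "g \<in> borel_measurable borel"
    using \<open>open B\<close> by (simp add: g_def)
  have "g (P x) = indicator (ball 0 1) x" for x
    by (simp add: g_def B_def indicator_def inj_image_mem_iff[OF \<open>inj P\<close>])
  then have gP: "(\<integral>\<^sup>+x. g (P x) \<partial>lborel) = emeasure lborel (ball 0 (1::real) :: 'a set)"
    by simp
  have gP_fin: "(\<integral>\<^sup>+x. g (P x) \<partial>lborel) \<noteq> \<infinity>" and gP_0: "(\<integral>\<^sup>+x. g (P x) \<partial>lborel) \<noteq> 0"
    unfolding gP using emeasure_lborel_ball_finite[of "0::'a" 1] content_ball_pos[of 1 "0::'a"]
    by (auto simp: measure_def)
  have "(\<integral>\<^sup>+x. g (P x) \<partial>lborel) * (ennreal \<bar>1 + b \<bullet> w\<bar> * (\<integral>\<^sup>+x. f (A x) \<partial>lborel))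
      = ennreal \<bar>1 + b \<bullet> w\<bar> * ((\<integral>\<^sup>+x. f (A (P x)) \<partial>lborel) * (\<integral>\<^sup>+x. g x \<partial>lborel))"
    using nn_integral_linear_proportional[OF linP bijP, of "\<lambda>x. f (A x)" g]
    by (simp add: mult_ac)
  also have "\<dots> = (ennreal \<bar>1 + b \<bullet> w\<bar> * (\<integral>\<^sup>+x. f (P (D x)) \<partial>lborel)) * (\<integral>\<^sup>+x. g x \<partial>lborel)"
    by (simp add: AP mult_ac)
  also have "\<dots> = (\<integral>\<^sup>+x. f (P x) \<partial>lborel) * (\<integral>\<^sup>+x. g x \<partial>lborel)"
    using nn_integral_lborel_scale_coordinate[OF i(1) c1, of "\<lambda>x. f (P x)"] by (simp add: D_def)
  also have "\<dots> = (\<integral>\<^sup>+x. g (P x) \<partial>lborel) * (\<integral>\<^sup>+x. f x \<partial>lborel)"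
    by (rule nn_integral_linear_proportional[OF linP bijP]) simp_all
  finally show ?thesis
    using gP_fin gP_0 by (simp add: ennreal_mult_cancel_left A_def)
qed

section \<open>The covariance form and Gaussian moment generating functions\<close>

lemma matrix_inv_mult_vector:
  fixes A :: "real^'p^'p"
  assumes "invertible A"
  shows "matrix_inv A *v (A *v x) = x" and "A *v (matrix_inv A *v x) = x"
proof -
  have "A ** matrix_inv A = mat 1 \<and> matrix_inv A ** A = mat 1"
    unfolding matrix_inv_def using assms unfolding invertible_def by (rule someI_ex)
  then show "matrix_inv A *v (A *v x) = x" and "A *v (matrix_inv A *v x) = x"
    by (simp_all add: matrix_vector_mul_assoc)
qed

lemma sig_inner_commute:
  assumes "nonsingular_cov S"
  shows "sig_inner S x y = sig_inner S y x"
proof -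
  have "y \<bullet> (S *v x) = (y v* S) \<bullet> x" by (simp add: dot_lmul_matrix)
  also have "y v* S = S *v y"
    using assms by (metis nonsingular_cov_def transpose_matrix_vector)
  finally show ?thesis by (simp add: sig_inner_def inner_commute)
qed

lemma sig_inner_simps:
  "sig_inner S (x + y) z = sig_inner S x z + sig_inner S y z"
  "sig_inner S z (x + y) = sig_inner S z x + sig_inner S z y"
  "sig_inner S (x - y) z = sig_inner S x z - sig_inner S y z"
  "sig_inner S z (x - y) = sig_inner S z x - sig_inner S z y"
  "sig_inner S (a *\<^sub>R x) z = a * sig_inner S x z"
  "sig_inner S z (a *\<^sub>R x) = a * sig_inner S z x"
  by (simp_all add: sig_inner_def inner_simps matrix_vector_right_distrib
      matrix_vector_mult_diff_distrib matrix_vector_mult_scaleR)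

text \<open>Semidefiniteness and invertibility give definiteness: if the form vanishes at
  \<open>x\<close>, then along \<open>S *v x - s *\<^sub>R x\<close> it is affine in
  \<open>s\<close> with slope \<open>- 2 * (y \<bullet> y)\<close>, where \<open>y = S *v x\<close>,
  and staying nonnegative forces \<open>y = 0\<close>. The value of \<open>s\<close> inserted below
  would make it \<open>- 1\<close>.\<close>

lemma sig_inner_pos:
  assumes S: "nonsingular_cov S" and x: "x \<noteq> 0"
  shows "0 < sig_inner S x x"
proof (rule ccontr)
  assume "\<not> 0 < sig_inner S x x"
  moreover have nonneg: "0 \<le> sig_inner S z z" for z
    using S by (simp add: nonsingular_cov_def sig_inner_def)
  ultimately have x0: "sig_inner S x x = 0" by (simp add: antisym not_less)
  define y where "y = S *v x"
  have yx: "sig_inner S y x = y \<bullet> y" by (simp add: sig_inner_def y_def)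
  have xy: "sig_inner S x y = y \<bullet> y" using sig_inner_commute[OF S] yx by metis
  have q: "0 \<le> sig_inner S y y - 2 * s * (y \<bullet> y)" for s
    using nonneg[of "y - s *\<^sub>R x"] by (simp add: sig_inner_simps x0 xy yx)
  have "y \<bullet> y = 0"
  proof (rule ccontr)
    assume "y \<bullet> y \<noteq> 0"
    then show False using q[of "(sig_inner S y y + 1) / (2 * (y \<bullet> y))"] by simp
  qed
  then have "S *v x = 0" by (simp add: y_def)
  then have "x = 0"
    using matrix_inv_mult_vector(1)[of S x] S by (simp add: nonsingular_cov_def)
  with x show False by simp
qed

text \<open>Substituting \<open>y = x + \<kappa> (b \<bullet> x) S b\<close> in the Gaussian density changes the exponent only
by a multiple of \<open>(b \<bullet> x)\<^sup>2\<close>, so the moment generating function of \<open>(b \<bullet> x)\<^sup>2\<close> is the modulus of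
this substitution.\<close>
lemma mvn_square_mgf:
  fixes S :: "real^'p^'p"
  assumes S: "nonsingular_cov S" and b: "b \<noteq> 0" and a: "a > 0"
    and prob: "prob_space (mvn S)"
  shows "(\<integral>\<^sup>+x. ennreal (exp ((1 - a\<^sup>2) / 2 * ((b \<bullet> x)\<^sup>2 / sig_inner S b b))) \<partial>mvn S)
    = ennreal (1 / a)"
proof -
  have [measurable]: "(\<lambda>x. mvn_density S x) \<in> borel_measurable borel"
    unfolding mvn_density_def
    by (intro borel_measurable_divide borel_measurable_const borel_measurable_continuous_onI
        continuous_intros linear_continuous_on matrix_vector_mul_bounded_linear) auto
  \<comment> \<open>The normalising constant matters only through the total mass, which
    \<open>prob\<close> supplies; no Gaussian integral is evaluated.\<close>
  have one: "(\<integral>\<^sup>+x. ennreal (mvn_density S x) \<partial>lborel) = 1"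
    using prob_space.emeasure_space_1[OF prob]
    by (simp add: mvn_def emeasure_density)
  show ?thesis
  \<comment> \<open>For \<open>a = 1\<close> the vector \<open>w\<close> below would vanish, which
    \<open>nn_integral_lborel_rank_one\<close> excludes.\<close>
  proof (cases "a = 1")
    case True
    then show ?thesis using prob_space.emeasure_space_1[OF prob] by simp
  next
    case False
    define v where "v = sig_inner S b b"
    have v: "v > 0" using sig_inner_pos[OF S b] by (simp add: v_def)
    \<comment> \<open>Chosen so that \<open>1 + b \<bullet> w = a\<close>: the substitution then has
      modulus \<open>a\<close>.\<close>
    define k where "k = (a - 1) / v"
    define w where "w = k *\<^sub>R (S *v b)"
    have bw: "b \<bullet> w = a - 1" using v by (simp add: w_def k_def v_def sig_inner_def)
    have dens: "mvn_density S (x + (b \<bullet> x) *\<^sub>R w)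
      = exp ((1 - a\<^sup>2) / 2 * ((b \<bullet> x)\<^sup>2 / v)) * mvn_density S x" for x
    proof -
      define u where "u = matrix_inv S *v x"
      have x: "x = S *v u"
        using S by (simp add: u_def matrix_inv_mult_vector nonsingular_cov_def)
      define c where "c = b \<bullet> x"
      have bx: "sig_inner S b u = c" by (simp add: c_def sig_inner_def x)
      have inv: "matrix_inv S *v (S *v z) = z" for z
        using S by (simp add: matrix_inv_mult_vector nonsingular_cov_def)
      have quad: "(S *v z) \<bullet> (matrix_inv S *v (S *v z)) = sig_inner S z z" for z
        by (simp add: inv sig_inner_def inner_commute)
      have y: "x + c *\<^sub>R w = S *v (u + (c * k) *\<^sub>R b)"
        by (simp add: x w_def matrix_vector_right_distrib matrix_vector_mult_scaleR)
      have "(x + c *\<^sub>R w) \<bullet> (matrix_inv S *v (x + c *\<^sub>R w))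
        = sig_inner S u u + 2 * (c * k) * c + (c * k)\<^sup>2 * v"
        unfolding y quad using bx sig_inner_commute[OF S, of u b]
        by (simp add: sig_inner_simps v_def power2_eq_square algebra_simps)
      moreover have "sig_inner S u u = x \<bullet> (matrix_inv S *v x)"
        unfolding x quad ..
      moreover have "2 * (c * k) * c + (c * k)\<^sup>2 * v = (a\<^sup>2 - 1) * (c\<^sup>2 / v)"
      proof -
        have "k * v = a - 1" using v by (simp add: k_def)
        then have "(2 * (c * k) * c + (c * k)\<^sup>2 * v) * v = 2 * c\<^sup>2 * (a - 1) + c\<^sup>2 * (a - 1)\<^sup>2"
          by (metis (no_types, opaque_lifting) distrib_right mult.assoc mult.commute power2_eq_square power_mult_distrib)
        also have "\<dots> = (a\<^sup>2 - 1) * c\<^sup>2" by (simp add: power2_eq_square algebra_simps)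
        finally show ?thesis using v by (simp add: field_simps)
      qed
      ultimately have E: "(x + c *\<^sub>R w) \<bullet> (matrix_inv S *v (x + c *\<^sub>R w))
        = x \<bullet> (matrix_inv S *v x) + (a\<^sup>2 - 1) * (c\<^sup>2 / v)" by simp
      have N: "- (x \<bullet> (matrix_inv S *v x) + (a\<^sup>2 - 1) * (c\<^sup>2 / v)) / 2
        = (1 - a\<^sup>2) / 2 * (c\<^sup>2 / v) + - (x \<bullet> (matrix_inv S *v x)) / 2"
        by (simp add: algebra_simps add_divide_distrib diff_divide_distrib)
      show ?thesis
        unfolding mvn_density_def c_def[symmetric] E N exp_add by simp
    qed
    have "(\<integral>\<^sup>+x. ennreal (exp ((1 - a\<^sup>2) / 2 * ((b \<bullet> x)\<^sup>2 / v))) \<partial>mvn S)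
      = (\<integral>\<^sup>+x. ennreal (mvn_density S x) * ennreal (exp ((1 - a\<^sup>2) / 2 * ((b \<bullet> x)\<^sup>2 / v))) \<partial>lborel)"
      unfolding mvn_def by (subst nn_integral_density) auto
    also have "\<dots> = (\<integral>\<^sup>+x. ennreal (mvn_density S (x + (b \<bullet> x) *\<^sub>R w)) \<partial>lborel)"
      by (intro nn_integral_cong) (simp only: dens ennreal_mult'[OF exp_ge_zero], rule mult.commute)
    finally have "ennreal a * (\<integral>\<^sup>+x. ennreal (exp ((1 - a\<^sup>2) / 2 * ((b \<bullet> x)\<^sup>2 / v))) \<partial>mvn S) = 1"
      using nn_integral_lborel_rank_one[of b w "\<lambda>x. ennreal (mvn_density S x)"] a False
      by (simp add: bw one)
    then have "ennreal (1 / a) * (ennreal a * (\<integral>\<^sup>+x. ennreal (exp ((1 - a\<^sup>2) / 2 * ((b \<bullet> x)\<^sup>2 / v))) \<partial>mvn S))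
      = ennreal (1 / a)" by simp
    moreover have "ennreal (1 / a) * ennreal a = 1"
      using a by (simp flip: ennreal_mult)
    ultimately show ?thesis
      by (simp add: v_def flip: mult.assoc)
  qed
qed

text \<open>Independence multiplies the row contributions. With
  \<open>l = (1 - a\<^sup>2) / 2\<close> the right side is
  \<open>(1 - 2 * l) powr (- n / 2)\<close>, the chi-square moment generating function with one
  degree of freedom per row, for every \<open>l < 1 / 2\<close>.\<close>

lemma gaussian_rows_mgf:
  fixes X :: "'w \<Rightarrow> real^'p::finite^'n::finite"
  assumes prob: "prob_space M" and S: "nonsingular_cov S"
    and indep: "prob_space.indep_vars M (\<lambda>_. borel) (\<lambda>i \<omega>. X \<omega> $ i) UNIV"
    and gauss: "\<And>i. distr M borel (\<lambda>\<omega>. X \<omega> $ i) = mvn S"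
    and b: "b \<noteq> 0" and a: "a > 0"
  shows "(\<integral>\<^sup>+\<omega>. ennreal (exp ((1 - a\<^sup>2) / 2 * (\<Sum>i\<in>UNIV. (b \<bullet> (X \<omega> $ i))\<^sup>2 / sig_inner S b b))) \<partial>M)
    = ennreal ((1 / a) ^ CARD('n))"
proof -
  interpret prob_space M by fact
  define F where "F x = ennreal (exp ((1 - a\<^sup>2) / 2 * ((b \<bullet> x)\<^sup>2 / sig_inner S b b)))" for x
  have F[measurable]: "F \<in> borel_measurable borel" unfolding F_def by measurable
  have X[measurable]: "(\<lambda>\<omega>. X \<omega> $ i) \<in> borel_measurable M" for i
    using indep by (simp add: indep_vars_def)
  have mvn: "prob_space (mvn S)"
    using prob_space_distr[OF X] gauss by metis
  have "(\<integral>\<^sup>+\<omega>. ennreal (exp ((1 - a\<^sup>2) / 2 * (\<Sum>i\<in>UNIV. (b \<bullet> (X \<omega> $ i))\<^sup>2 / sig_inner S b b))) \<partial>M)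
    = (\<integral>\<^sup>+\<omega>. (\<Prod>i\<in>UNIV. F (X \<omega> $ i)) \<partial>M)"
    by (simp add: F_def sum_distrib_left exp_sum prod_ennreal)
  also have "\<dots> = (\<Prod>i\<in>UNIV. \<integral>\<^sup>+\<omega>. F (X \<omega> $ i) \<partial>M)"
    by (intro indep_vars_nn_integral indep_vars_compose2[OF indep]) auto
  also have "\<dots> = (\<Prod>i\<in>(UNIV::'n set). ennreal (1 / a))"
  proof (rule prod.cong)
    fix i :: 'n
    have "(\<integral>\<^sup>+\<omega>. F (X \<omega> $ i) \<partial>M) = (\<integral>\<^sup>+x. F x \<partial>mvn S)"
      by (simp add: gauss[of i, symmetric] nn_integral_distr)
    also have "\<dots> = ennreal (1 / a)"
      unfolding F_def by (rule mvn_square_mgf[OF S b a mvn])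
    finally show "(\<integral>\<^sup>+\<omega>. F (X \<omega> $ i) \<partial>M) = ennreal (1 / a)" .
  qed simp
  also have "\<dots> = ennreal ((1 / a) ^ CARD('n))"
    using a by (simp add: ennreal_power del: divide_const_simps)
  finally show ?thesis .
qed

section \<open>Chi-square tails for a fixed coefficient vector\<close>

text \<open>The gap vanishes at 1 and has derivative \<open>(1 - 1 / x)\<^sup>2 / 2\<close>. At
  \<open>z = 1 + 2 * q\<close> it brings the exponent of the upper tail to exactly
  \<open>- q\<^sup>2\<close> per degree of freedom.\<close>

lemma ln_le_half_diff_inverse:
  assumes "1 \<le> (z::real)"
  shows "ln z \<le> (z - 1 / z) / 2"
proof -
  have "(\<lambda>z::real. (z - 1 / z) / 2 - ln z) 1 \<le> (\<lambda>z::real. (z - 1 / z) / 2 - ln z) z"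
  proof (rule DERIV_nonneg_imp_nondecreasing[OF assms])
    fix x :: real assume x: "1 \<le> x" "x \<le> z"
    have "((\<lambda>z::real. (z - 1 / z) / 2 - ln z) has_real_derivative (1 - 1 / x)\<^sup>2 / 2) (at x)"
      using x by (auto intro!: derivative_eq_intros simp: power2_eq_square field_simps)
    then show "\<exists>y. ((\<lambda>z::real. (z - 1 / z) / 2 - ln z) has_real_derivative y) (at x) \<and> 0 \<le> y"
      by (intro exI conjI) auto
  qed
  then show ?thesis by simp
qed

text \<open>The counterpart for the lower tail; the gap vanishes at 0 and has derivative
  \<open>8 * x\<^sup>2 / (1 + 2 * x)\<close>.\<close>

lemma ln_one_plus_ge_quadratic:
  assumes "0 \<le> (q::real)"
  shows "2 * q - 2 * q\<^sup>2 \<le> ln (1 + 2 * q)"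
proof -
  have "(\<lambda>q::real. ln (1 + 2 * q) - 2 * q + 2 * q\<^sup>2) 0 \<le> (\<lambda>q::real. ln (1 + 2 * q) - 2 * q + 2 * q\<^sup>2) q"
  proof (rule DERIV_nonneg_imp_nondecreasing[OF assms])
    fix x :: real assume x: "0 \<le> x" "x \<le> q"
    have "((\<lambda>q::real. ln (1 + 2 * q) - 2 * q + 2 * q\<^sup>2) has_real_derivative 8 * x\<^sup>2 / (1 + 2 * x)) (at x)"
      using x by (auto intro!: derivative_eq_intros simp: power2_eq_square field_simps)
    then show "\<exists>y. ((\<lambda>q::real. ln (1 + 2 * q) - 2 * q + 2 * q\<^sup>2) has_real_derivative y) (at x) \<and> 0 \<le> y"
      using x by (intro exI[of _ "8 * x\<^sup>2 / (1 + 2 * x)"] conjI) auto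
  qed
  then show ?thesis by simp
qed

text \<open>The Chernoff bounds of Laurent and Massart, with \<open>q = \<surd>(u/n)\<close>: the optimal exponents
are \<open>q / (1 + 2 q)\<close> for the upper tail and \<open>- q\<close> for the lower one, that is
\<open>a\<^sup>2 = 1 / (1 + 2 q)\<close> and \<open>a\<^sup>2 = 1 + 2 q\<close> in the hypothesis \<open>mgf\<close>.\<close>
lemma chi_square_tail:
  fixes W :: "'w \<Rightarrow> real" and q :: real and n :: nat
  assumes prob: "prob_space M" and W[measurable]: "W \<in> borel_measurable M"
    and mgf: "\<And>a. a > 0 \<Longrightarrow>
      (\<integral>\<^sup>+\<omega>. ennreal (exp ((1 - a\<^sup>2) / 2 * W \<omega>)) \<partial>M) = ennreal ((1 / a) ^ n)"
    and q: "q > 0" and n: "n > 0"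
  shows "measure M {\<omega> \<in> space M. 2 * q + 2 * q\<^sup>2 \<le> \<bar>W \<omega> / n - 1\<bar>} \<le> 2 * exp (- (n * q\<^sup>2))"
proof -
  interpret prob_space M by fact
  define r where "r = 1 + 2 * q"
  have r: "r > 1" using q by (simp add: r_def)
  have pow: "(1 / a) ^ n = exp (- (n * ln a))" if "a > 0" for a :: real
    using that by (simp add: exp_minus exp_of_nat_mult power_one_over inverse_eq_divide)
  have upper: "prob {\<omega> \<in> space M. n * (1 + 2 * q + 2 * q\<^sup>2) \<le> W \<omega>} \<le> exp (- (n * q\<^sup>2))"
  proof -
    define a where "a = 1 / sqrt r"
    have a: "a > 0" "a\<^sup>2 = 1 / r" "ln a = - (ln r / 2)"
      using r by (auto simp: a_def power_divide ln_div ln_sqrt)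
    have s: "(1 - a\<^sup>2) / 2 = q / r" using r by (simp add: a r_def field_simps)
    have "emeasure M {\<omega> \<in> space M. n * (1 + 2 * q + 2 * q\<^sup>2) \<le> W \<omega>}
      \<le> ennreal (exp (- (q / r) * (n * (1 + 2 * q + 2 * q\<^sup>2))))
        * (\<integral>\<^sup>+\<omega>. ennreal (exp (q / r * W \<omega>)) * indicator (space M) \<omega> \<partial>M)"
      by (rule Chernoff_ineq_nn_integral_ge) (use q r in auto)
    also have "(\<integral>\<^sup>+\<omega>. ennreal (exp (q / r * W \<omega>)) * indicator (space M) \<omega> \<partial>M)
      = (\<integral>\<^sup>+\<omega>. ennreal (exp (q / r * W \<omega>)) \<partial>M)"
      by (intro nn_integral_cong) auto
    also have "\<dots> = ennreal (exp (n * (ln r / 2)))"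
      using mgf[OF a(1)] a(3) unfolding s pow[OF a(1)] by simp
    also have "ennreal (exp (- (q / r) * (n * (1 + 2 * q + 2 * q\<^sup>2)))) * ennreal (exp (n * (ln r / 2)))
      = ennreal (exp (n * (ln r / 2 - q / r * (1 + 2 * q + 2 * q\<^sup>2))))"
      by (simp add: algebra_simps flip: ennreal_mult exp_add)
    also have "\<dots> \<le> ennreal (exp (- (n * q\<^sup>2)))"
    proof -
      have "(r - 1 / r) / 4 - q / r * (1 + 2 * q + 2 * q\<^sup>2) = - q\<^sup>2"
      proof -
        have "((r - 1 / r) / 4 - q / r * (1 + 2 * q + 2 * q\<^sup>2)) * r
          = (r\<^sup>2 - 1) / 4 - q * (1 + 2 * q + 2 * q\<^sup>2)"
          using r by (simp add: field_simps power2_eq_square)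
        also have "\<dots> = - q\<^sup>2 * r" by (simp add: r_def power2_eq_square algebra_simps)
        finally show ?thesis
          using r by (metis mult_right_cancel not_one_less_zero)
      qed
      moreover have "ln r / 2 \<le> (r - 1 / r) / 4"
        using ln_le_half_diff_inverse[OF less_imp_le[OF r]] by simp
      ultimately have "ln r / 2 - q / r * (1 + 2 * q + 2 * q\<^sup>2) \<le> - q\<^sup>2"
        by (metis diff_right_mono)
      then have "n * (ln r / 2 - q / r * (1 + 2 * q + 2 * q\<^sup>2)) \<le> n * - q\<^sup>2"
        by (intro mult_left_mono) auto
      then show ?thesis by (intro ennreal_leI) simp
    qed
    finally show ?thesis by (simp add: emeasure_eq_measure)
  qed
  \<comment> \<open>The term \<open>2 * q\<^sup>2\<close> keeps the two thresholds symmetric about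
    1. Here it contributes \<open>- 2 * q ^ 3\<close> to the exponent, which is dropped.\<close>
  have lower: "prob {\<omega> \<in> space M. W \<omega> \<le> n * (1 - 2 * q - 2 * q\<^sup>2)} \<le> exp (- (n * q\<^sup>2))"
  proof -
    define a where "a = sqrt r"
    have a: "a > 0" "a\<^sup>2 = r" "ln a = ln r / 2"
      using r by (auto simp: a_def ln_sqrt)
    have s: "(1 - a\<^sup>2) / 2 = - q" by (simp add: a r_def)
    have "emeasure M {\<omega> \<in> space M. W \<omega> \<le> n * (1 - 2 * q - 2 * q\<^sup>2)}
      \<le> ennreal (exp (q * (n * (1 - 2 * q - 2 * q\<^sup>2))))
        * (\<integral>\<^sup>+\<omega>. ennreal (exp (- q * W \<omega>)) * indicator (space M) \<omega> \<partial>M)"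
      by (rule Chernoff_ineq_nn_integral_le) (use q in auto)
    also have "(\<integral>\<^sup>+\<omega>. ennreal (exp (- q * W \<omega>)) * indicator (space M) \<omega> \<partial>M)
      = (\<integral>\<^sup>+\<omega>. ennreal (exp (- q * W \<omega>)) \<partial>M)"
      by (intro nn_integral_cong) auto
    also have "\<dots> = ennreal (exp (- (n * (ln r / 2))))"
      using mgf[OF a(1)] a(3) unfolding s pow[OF a(1)] by simp
    also have "ennreal (exp (q * (n * (1 - 2 * q - 2 * q\<^sup>2)))) * ennreal (exp (- (n * (ln r / 2))))
      = ennreal (exp (n * (q * (1 - 2 * q - 2 * q\<^sup>2) - ln r / 2)))"
      by (simp add: algebra_simps flip: ennreal_mult exp_add)
    also have "\<dots> \<le> ennreal (exp (- (n * q\<^sup>2)))"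
    proof -
      have "q * (1 - 2 * q - 2 * q\<^sup>2) = q - 2 * q\<^sup>2 - 2 * q ^ 3"
        by (simp add: power2_eq_square power3_eq_cube algebra_simps)
      moreover have "0 \<le> q ^ 3" using q by simp
      ultimately have "q * (1 - 2 * q - 2 * q\<^sup>2) - ln r / 2 \<le> - q\<^sup>2"
        using ln_one_plus_ge_quadratic[of q] q unfolding r_def by linarith
      then have "n * (q * (1 - 2 * q - 2 * q\<^sup>2) - ln r / 2) \<le> n * - q\<^sup>2"
        by (intro mult_left_mono) auto
      then show ?thesis by (intro ennreal_leI) simp
    qed
    finally show ?thesis by (simp add: emeasure_eq_measure)
  qed
  have "{\<omega> \<in> space M. 2 * q + 2 * q\<^sup>2 \<le> \<bar>W \<omega> / n - 1\<bar>}
    \<subseteq> {\<omega> \<in> space M. n * (1 + 2 * q + 2 * q\<^sup>2) \<le> W \<omega>} \<union> {\<omega> \<in> space M. W \<omega> \<le> n * (1 - 2 * q - 2 * q\<^sup>2)}"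
    using n by (auto simp: abs_if field_simps split: if_splits)
  then have "prob {\<omega> \<in> space M. 2 * q + 2 * q\<^sup>2 \<le> \<bar>W \<omega> / n - 1\<bar>}
    \<le> prob ({\<omega> \<in> space M. n * (1 + 2 * q + 2 * q\<^sup>2) \<le> W \<omega>} \<union> {\<omega> \<in> space M. W \<omega> \<le> n * (1 - 2 * q - 2 * q\<^sup>2)})"
    by (intro finite_measure_mono) auto
  also have "\<dots> \<le> prob {\<omega> \<in> space M. n * (1 + 2 * q + 2 * q\<^sup>2) \<le> W \<omega>}
    + prob {\<omega> \<in> space M. W \<omega> \<le> n * (1 - 2 * q - 2 * q\<^sup>2)}"
    by (rule measure_Un_le) auto
  also have "\<dots> \<le> 2 * exp (- (n * q\<^sup>2))" using upper lower by simp
  finally show ?thesis .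
qed

text \<open>Dividing by the variance \<open>sig_inner S b b\<close> of each entry of
  \<open>X \<omega> *v b\<close> makes the bound independent of \<open>b\<close>, so one inequality
  serves all regressions. Measurability is recorded for the union bound.\<close>

lemma gaussian_rows_tail:
  fixes X :: "'w \<Rightarrow> real^'p::finite^'n::finite"
  assumes prob: "prob_space M" and S: "nonsingular_cov S"
    and indep: "prob_space.indep_vars M (\<lambda>_. borel) (\<lambda>i \<omega>. X \<omega> $ i) UNIV"
    and gauss: "\<And>i. distr M borel (\<lambda>\<omega>. X \<omega> $ i) = mvn S"
    and b: "b \<noteq> 0" and u: "u > 0"
  shows "{\<omega> \<in> space M. 2 * sqrt (u / CARD('n)) + 2 * (u / CARD('n))
      \<le> \<bar>(norm_n_sq (X \<omega> *v b) - sig_inner S b b) / sig_inner S b b\<bar>} \<in> sets M" (is "?A \<in> _")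
    and "measure M {\<omega> \<in> space M. 2 * sqrt (u / CARD('n)) + 2 * (u / CARD('n))
      \<le> \<bar>(norm_n_sq (X \<omega> *v b) - sig_inner S b b) / sig_inner S b b\<bar>} \<le> 2 * exp (- u)"
proof -
  interpret prob_space M by fact
  define W where "W \<omega> = (\<Sum>i\<in>UNIV. (b \<bullet> (X \<omega> $ i))\<^sup>2 / sig_inner S b b)" for \<omega>
  have X[measurable]: "(\<lambda>\<omega>. X \<omega> $ i) \<in> borel_measurable M" for i
    using indep by (simp add: indep_vars_def)
  have W[measurable]: "W \<in> borel_measurable M" unfolding W_def by measurable
  have v: "sig_inner S b b > 0" by (rule sig_inner_pos[OF S b])
  have entry: "(X \<omega> *v b) $ i = b \<bullet> (X \<omega> $ i)" for \<omega> i
    by (simp add: matrix_vector_mult_def inner_vec_def mult.commute)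
  have "norm_n_sq (X \<omega> *v b) = (\<Sum>i\<in>UNIV. (b \<bullet> (X \<omega> $ i))\<^sup>2) / CARD('n)" for \<omega>
    by (simp add: norm_n_sq_def inner_vec_def[of "X \<omega> *v b"] entry power2_eq_square)
  then have eq: "(norm_n_sq (X \<omega> *v b) - sig_inner S b b) / sig_inner S b b = W \<omega> / CARD('n) - 1" for \<omega>
    using v by (simp add: W_def diff_divide_distrib mult.commute flip: sum_divide_distrib)
  define q where "q = sqrt (u / CARD('n))"
  have q: "q > 0" "q\<^sup>2 = u / CARD('n)" "CARD('n) * q\<^sup>2 = u" using u by (auto simp: q_def)
  show "?A \<in> sets M" unfolding eq by measurable
  show "measure M ?A \<le> 2 * exp (- u)"
    using chi_square_tail[OF prob W, of "CARD('n)" q] gaussian_rows_mgf[OF prob S indep gauss b] q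
    unfolding eq W_def q_def[symmetric] by simp
qed

section \<open>Projections in the covariance inner product and their supports\<close>

text \<open>The characterisation of \<open>beta_tilde\<close> with an arbitrary set \<open>K\<close>
  in place of the later variables, so that supports can be used without reference to a
  permutation.\<close>

definition proj_coef :: "real^'p^'p \<Rightarrow> 'p set \<Rightarrow> real^'p \<Rightarrow> real^'p" where
  "proj_coef S K y = (THE b. (\<forall>k. k \<notin> K \<longrightarrow> b $ k = 0) \<and>
      (\<forall>k\<in>K. sig_inner S (y - b) (axis k 1) = 0))"

lemma beta_tilde_eq_proj_coef: "beta_tilde S \<pi> j = proj_coef S (later_vars \<pi> j) (axis j 1)"
  by (simp add: beta_tilde_def proj_coef_def)

lemma sig_inner_axis:
  assumes "nonsingular_cov S"
  shows "sig_inner S x (axis k 1) = (S *v x) $ k"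
  by (subst sig_inner_commute[OF assms]) (simp add: sig_inner_def inner_axis')

text \<open>The conditions form one square linear system: normal equations on \<open>K\<close>,
  vanishing coordinates off \<open>K\<close>. In its kernel every product
  \<open>b $ k * (S *v b) $ k\<close> is zero, so \<open>sig_inner S b b = 0\<close> and
  \<open>b = 0\<close>; injectivity yields surjectivity.\<close>

lemma ex1_proj_coef:
  fixes S :: "real^'p^'p"
  assumes S: "nonsingular_cov S"
  shows "\<exists>!b. (\<forall>k. k \<notin> K \<longrightarrow> b $ k = 0) \<and> (\<forall>k\<in>K. sig_inner S (y - b) (axis k 1) = 0)"
proof -
  define f where "f b = (\<chi> k. if k \<in> K then (S *v b) $ k else b $ k)" for b :: "real^'p"
  have lin: "linear f"
    by (rule linearI)
      (auto simp: f_def vec_eq_iff matrix_vector_right_distrib matrix_vector_mult_scaleR)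
  have ker: "b = 0" if "f b = 0" for b
  proof (rule ccontr)
    assume "b \<noteq> 0"
    have "b $ k * (S *v b) $ k = 0" for k
      using arg_cong[OF that, of "\<lambda>v. v $ k"] by (auto simp: f_def split: if_splits)
    then have "sig_inner S b b = 0" by (auto simp: sig_inner_def inner_vec_def intro!: sum.neutral)
    then show False using sig_inner_pos[OF S \<open>b \<noteq> 0\<close>] by simp
  qed
  then have inj: "inj f" using linear_injective_0[OF lin] by auto
  then have "surj f" by (rule linear_injective_imp_surjective[OF lin _ refl])
  have iff: "(\<forall>k. k \<notin> K \<longrightarrow> b $ k = 0) \<and> (\<forall>k\<in>K. sig_inner S (y - b) (axis k 1) = 0)
    \<longleftrightarrow> f b = (\<chi> k. if k \<in> K then (S *v y) $ k else 0)" for b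
    by (auto simp: f_def vec_eq_iff sig_inner_axis[OF S] matrix_vector_mult_diff_distrib)
  obtain b where b: "f b = (\<chi> k. if k \<in> K then (S *v y) $ k else 0)"
    using \<open>surj f\<close> by (metis surjD)
  show ?thesis
    unfolding iff
  proof (rule ex1I)
    show "f b = (\<chi> k. if k \<in> K then (S *v y) $ k else 0)" by (rule b)
    fix c assume "f c = (\<chi> k. if k \<in> K then (S *v y) $ k else 0)"
    then show "c = b" using injD[OF inj] b by simp
  qed
qed

lemma proj_coef:
  assumes "nonsingular_cov S"
  shows "k \<notin> K \<Longrightarrow> proj_coef S K y $ k = 0"
    and "k \<in> K \<Longrightarrow> sig_inner S (y - proj_coef S K y) (axis k 1) = 0"
  using theI'[OF ex1_proj_coef[OF assms, of K y]] by (auto simp: proj_coef_def)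

lemma proj_coef_eqI:
  assumes "nonsingular_cov S"
    and "\<And>k. k \<notin> K \<Longrightarrow> b $ k = 0" "\<And>k. k \<in> K \<Longrightarrow> sig_inner S (y - b) (axis k 1) = 0"
  shows "proj_coef S K y = b"
  unfolding proj_coef_def
  by (rule the1_equality[OF ex1_proj_coef[OF assms(1)]]) (use assms in auto)

text \<open>The orthogonality conditions on the support are among those on \<open>K\<close>, and off
  its support the vector vanishes trivially, so uniqueness applies.\<close>

lemma proj_coef_support:
  assumes S: "nonsingular_cov S"
  shows "proj_coef S {k. proj_coef S K y $ k \<noteq> 0} y = proj_coef S K y"
proof (rule proj_coef_eqI[OF S])
  fix k assume "k \<in> {k. proj_coef S K y $ k \<noteq> 0}"
  then have "k \<in> K" using proj_coef(1)[OF S] by auto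
  then show "sig_inner S (y - proj_coef S K y) (axis k 1) = 0" by (rule proj_coef(2)[OF S])
qed simp

text \<open>Coordinate \<open>j\<close> of the residual is 1. Hence its variance is positive and the
  relative deviation is meaningful.\<close>

lemma residual_nonzero:
  assumes "nonsingular_cov S" "j \<notin> K"
  shows "axis j 1 - proj_coef S K (axis j 1) \<noteq> 0"
proof -
  have "(axis j 1 - proj_coef S K (axis j 1)) $ j = 1"
    using assms by (simp add: proj_coef)
  then show ?thesis by (metis zero_index zero_neq_one)
qed

lemma not_mem_later_vars:
  fixes \<pi> :: "nat \<Rightarrow> 'p::finite"
  assumes "is_perm \<pi>"
  shows "j \<notin> later_vars \<pi> j"
proof
  assume "j \<in> later_vars \<pi> j"
  then obtain m where m: "j = \<pi> m" "Suc (perm_pos \<pi> j) \<le> m" "m < CARD('p)"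
    by (auto simp: later_vars_def)
  have "inj_on \<pi> {..<CARD('p)}" using assms by (simp add: is_perm_def bij_betw_def)
  then have "perm_pos \<pi> j = m"
    unfolding perm_pos_def m(1) by (rule the_inv_into_f_f) (use m in simp)
  with m show False by simp
qed

section \<open>Weights of the supports and arithmetic of the threshold\<close>

lemma sum_Pow_power_card:
  fixes x :: real
  assumes "finite A"
  shows "(\<Sum>K\<in>Pow A. x ^ card K) = (1 + x) ^ card A"
  using prod_add[OF assms, of "\<lambda>_. x" "\<lambda>_. 1"] by (simp add: add.commute)

text \<open>The exponent \<open>2 / 3\<close> is what remains of \<open>5 / 3\<close> after paying
  for the \<open>p\<close> choices of \<open>j\<close>. The case \<open>p = 2\<close> reads
  \<open>27 / 8 \<le> 4\<close> after cubing; it is separate because the estimate by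
  \<open>exp (1 - 1 / p)\<close> used for larger \<open>p\<close> is too weak there.\<close>

lemma one_plus_inverse_power_le:
  assumes "2 \<le> (p::nat)"
  shows "(1 + 1 / real p) ^ (p - 1) \<le> exp (2 / 3 * ln p)"
proof (cases "p = 2")
  case True
  have "ln (3 / 2 :: real) \<le> 2 / 3 * ln 2"
  proof -
    have "3 * ln (3 / 2 :: real) = ln ((3 / 2) ^ 3)" by (simp add: ln_realpow)
    also have "\<dots> \<le> ln (2 ^ 2)" by (subst ln_le_cancel_iff) (simp_all add: power3_eq_cube)
    also have "\<dots> = 2 * ln 2" using ln_realpow[of "2::real" 2] by simp
    finally show ?thesis by simp
  qed
  then have "3 / 2 \<le> exp (2 / 3 * ln (2::real))"
    by (subst (asm) exp_le_cancel_iff[symmetric]) simp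
  with True show ?thesis by simp
next
  case False
  then have p: "3 \<le> p" using assms by simp
  have "ln (real p / 3) \<ge> 1 - 3 / p"
    using ln_le_minus_one[of "3 / real p"] p ln_inverse[of "real p / 3"] by simp
  moreover have "ln (3::real) \<ge> 1" using exp_le by (simp add: ln_ge_iff)
  ultimately have "ln p \<ge> 2 - 3 / p" using p by (simp add: ln_div)
  moreover have "3 / real p \<le> 1" using p by simp
  ultimately have ln: "1 - 1 / p \<le> 2 / 3 * ln p" by linarith
  have "(1 + 1 / real p) ^ (p - 1) \<le> exp (1 / p) ^ (p - 1)"
    by (intro power_mono exp_ge_add_one_self) auto
  also have "\<dots> = exp (real (p - 1) * (1 / p))" by (rule exp_of_nat_mult[symmetric])
  also have "real (p - 1) * (1 / p) = 1 - 1 / p" using p by (simp add: of_nat_diff field_simps)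
  also have "exp (1 - 1 / p) \<le> exp (2 / 3 * ln p)" using ln by simp
  finally show ?thesis by simp
qed

text \<open>The exponent carries \<open>5/3 ln p\<close> and not the \<open>2 ln p\<close> of the crude count \<open>p\<^sup>s\<close> of supports
of size \<open>s\<close>: with \<open>2 ln p\<close> the square of the exponent could exceed \<open>4 (t\<^sup>2 + ln\<^sup>2 p)\<close> when \<open>s = 0\<close>. The
constant must be at most \<open>\<surd>3\<close> there, and counting supports by the binomial theorem allows this.\<close>
lemma deviation_bound:
  fixes L t n alpha :: real and s :: nat
  assumes L: "L > 0" and t: "t > 0" and n: "n > 0" and s: "s \<le> alpha * n / L"
  defines "u \<equiv> t + (s + 5 / 3) * L"
  shows "(2 * sqrt (u / n) + 2 * (u / n))\<^sup>2
    \<le> 8 * ((t + (1 + 8 * alpha) * s * L + 2 * L) / n) + 8 * (4 * (t\<^sup>2 + L\<^sup>2) / n\<^sup>2)"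
proof -
  have u: "u > 0" using t L by (simp add: u_def add_pos_nonneg)
  define z where "z = sqrt (u / n)"
  have z: "z\<^sup>2 = u / n" using u n by (simp add: z_def)
  \<comment> \<open>Convexity of the square; this gives both factors 8 of the threshold.\<close>
  have "(2 * z + 2 * z\<^sup>2)\<^sup>2 \<le> 8 * z\<^sup>2 + 8 * (z\<^sup>2)\<^sup>2"
    using zero_le_square[of "2 * z - 2 * z\<^sup>2"] by (simp add: power2_eq_square algebra_simps)
  then have 1: "(2 * sqrt (u / n) + 2 * (u / n))\<^sup>2 \<le> 8 * (u / n) + 8 * (u\<^sup>2 / n\<^sup>2)"
    unfolding z unfolding z_def by (simp only: power_divide)
  \<comment> \<open>Young's inequality with the coefficient 4 that the threshold grants to
    \<open>t\<^sup>2\<close>; the other coefficient is then \<open>4 / 3\<close>.\<close>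
  have "u\<^sup>2 \<le> 4 * t\<^sup>2 + 4 / 3 * ((s + 5 / 3) * L)\<^sup>2"
    using zero_le_square[of "3 * t - (s + 5 / 3) * L"]
    unfolding u_def by (simp add: power2_eq_square algebra_simps)
  also have "4 / 3 * ((s + 5 / 3) * L)\<^sup>2 \<le> (8 * (real s)\<^sup>2 + 4) * L\<^sup>2"
  proof -
    \<comment> \<open>As \<open>s\<close> is a natural number, the cross term
      \<open>40 / 9 * s\<close> is absorbed by the square: \<open>4 / 3 + 40 / 9 \<le> 8\<close>,
      and the constant is \<open>100 / 27 \<le> 4\<close>.\<close>
    have "real s \<le> (real s)\<^sup>2" by (cases s) (simp_all add: power2_eq_square)
    then have "4 / 3 * (s + 5 / 3)\<^sup>2 \<le> 8 * (real s)\<^sup>2 + 4"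
      using zero_le_square[of "real s"] by (simp add: power2_eq_square algebra_simps)
    then show ?thesis
      unfolding power_mult_distrib mult.assoc[symmetric] by (intro mult_right_mono) auto
  qed
  finally have "u\<^sup>2 / n\<^sup>2 \<le> (4 * (t\<^sup>2 + L\<^sup>2) + 8 * (s * L)\<^sup>2) / n\<^sup>2"
    by (intro divide_right_mono) (simp_all add: algebra_simps power_mult_distrib)
  also have "\<dots> = 4 * (t\<^sup>2 + L\<^sup>2) / n\<^sup>2 + 8 * ((s * L) / n * ((s * L) / n))"
    by (simp add: add_divide_distrib power2_eq_square)
  also have "\<dots> \<le> 4 * (t\<^sup>2 + L\<^sup>2) / n\<^sup>2 + 8 * (alpha * ((s * L) / n))"
  proof -
    \<comment> \<open>The sparsity assumption enters here, on one of the two factors.\<close>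
    have "s * L / n \<le> alpha" using s L n by (simp add: field_simps)
    then show ?thesis using L n by (intro add_left_mono mult_left_mono mult_right_mono) auto
  qed
  finally have 2: "u\<^sup>2 / n\<^sup>2 \<le> 4 * (t\<^sup>2 + L\<^sup>2) / n\<^sup>2 + 8 * (alpha * ((s * L) / n))" .
  have 3: "u / n \<le> (t + s * L + 2 * L) / n"
    using n L by (intro divide_right_mono) (simp_all add: u_def algebra_simps)
  have "(t + (1 + 8 * alpha) * s * L + 2 * L) / n
    = (t + s * L + 2 * L) / n + 8 * (alpha * ((s * L) / n))"
    by (simp add: add_divide_distrib algebra_simps)
  then show ?thesis using 1 2 3 by linarith
qed

lemma sum_deviation_bound:
  fixes s :: "'p::finite \<Rightarrow> nat" and t L n alpha :: real
  shows "(\<Sum>j\<in>UNIV. 8 * ((t + (1 + 8 * alpha) * s j * L + 2 * L) / n) + 8 * (4 * (t\<^sup>2 + L\<^sup>2) / n\<^sup>2))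
   = 8 * ((real CARD('p) * t + (1 + 8 * alpha) * (\<Sum>j\<in>UNIV. s j) * L
               + 2 * real CARD('p) * L) / n) + 8 * (4 * real CARD('p) * (t\<^sup>2 + L\<^sup>2) / n\<^sup>2)"
proof -
  have "(\<Sum>j\<in>UNIV. 8 * ((t + (1 + 8 * alpha) * s j * L + 2 * L) / n) + 8 * (4 * (t\<^sup>2 + L\<^sup>2) / n\<^sup>2))
   = (\<Sum>j\<in>UNIV. (8 * ((t + 2 * L) / n) + 8 * (4 * (t\<^sup>2 + L\<^sup>2) / n\<^sup>2)) + 8 * ((1 + 8 * alpha) * L / n) * s j)"
    by (intro sum.cong refl) (simp add: add_divide_distrib distrib_left mult_ac)
  also have "\<dots> = CARD('p) * (8 * ((t + 2 * L) / n) + 8 * (4 * (t\<^sup>2 + L\<^sup>2) / n\<^sup>2)) + 8 * ((1 + 8 * alpha) * L / n) * (\<Sum>j\<in>UNIV. s j)"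
    by (simp only: sum.distrib sum_constant sum_distrib_left of_nat_sum distrib_left)
  finally show ?thesis by (simp add: add_divide_distrib distrib_left mult_ac)
qed

section \<open>Union bound and passage to all permutations\<close>

lemma deviation_union_bound:
  fixes X :: "'w \<Rightarrow> real^'p::finite^'n::finite" and S :: "real^'p^'p" and t :: real
  defines "L \<equiv> ln (real CARD('p))"
  defines "u \<equiv> \<lambda>K :: 'p set. t + (card K + 5 / 3) * L"
  defines "r \<equiv> \<lambda>j K. axis j 1 - proj_coef S K (axis j 1)"
  defines "A \<equiv> \<lambda>M j K. {\<omega> \<in> space M. 2 * sqrt (u K / CARD('n)) + 2 * (u K / CARD('n))
      \<le> \<bar>(norm_n_sq (X \<omega> *v r j K) - sig_inner S (r j K) (r j K)) / sig_inner S (r j K) (r j K)\<bar>}"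
  assumes p2: "CARD('p) \<ge> 2" and prob: "prob_space M" and S: "nonsingular_cov S"
    and indep: "prob_space.indep_vars M (\<lambda>_. borel) (\<lambda>i \<omega>. X \<omega> $ i) UNIV"
    and gauss: "\<And>i. distr M borel (\<lambda>\<omega>. X \<omega> $ i) = mvn S"
    and t: "t > 0"
  shows "(\<Union>j. \<Union>K\<in>Pow (- {j}). A M j K) \<in> sets M"
    and "measure M (\<Union>j. \<Union>K\<in>Pow (- {j}). A M j K) \<le> 2 * exp (- t)"
proof -
  interpret prob_space M by fact
  define p where "p = CARD('p)"
  have L: "L > 0" using p2 by (simp add: L_def)
  have expL: "exp (- L) = 1 / p" using p2 by (simp add: L_def p_def exp_minus inverse_eq_divide)
  have u: "u K > 0" for K using t L by (simp add: u_def add_pos_nonneg)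
  have r: "r j K \<noteq> 0" if "K \<in> Pow (- {j})" for j K
    unfolding r_def using that by (intro residual_nonzero[OF S]) auto
  have A_sets: "A M j K \<in> sets M" if "K \<in> Pow (- {j})" for j K
    unfolding A_def by (rule gaussian_rows_tail(1)[OF prob S indep gauss r[OF that] u])
  have A_le: "measure M (A M j K) \<le> 2 * exp (- u K)" if "K \<in> Pow (- {j})" for j K
    unfolding A_def by (rule gaussian_rows_tail(2)[OF prob S indep gauss r[OF that] u])
  have expu: "exp (- u K) = exp (- t) * exp (- (5 / 3 * L)) * (1 / p) ^ card K" for K
    unfolding expL[symmetric] exp_of_nat_mult[symmetric]
    by (simp add: u_def algebra_simps flip: exp_add)
  have sets: "(\<Union>K\<in>Pow (- {j}). A M j K) \<in> sets M" for j
    by (rule sets.finite_UN[OF _ A_sets]) simp_all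
  show "(\<Union>j. \<Union>K\<in>Pow (- {j}). A M j K) \<in> sets M"
    by (rule sets.finite_UN[OF finite sets])
  have inner: "measure M (\<Union>K\<in>Pow (- {j}). A M j K)
    \<le> 2 * exp (- t) * (exp (- (5 / 3 * L)) * (1 + 1 / p) ^ (p - 1))" for j
  proof -
    have "measure M (\<Union>K\<in>Pow (- {j}). A M j K) \<le> (\<Sum>K\<in>Pow (- {j}). measure M (A M j K))"
      by (rule finite_measure_subadditive_finite) (use A_sets in auto)
    also have "\<dots> \<le> (\<Sum>K\<in>Pow (- {j}). 2 * exp (- u K))"
      by (intro sum_mono A_le)
    also have "\<dots> = 2 * exp (- t) * (exp (- (5 / 3 * L)) * (\<Sum>K\<in>Pow (- {j}). (1 / p) ^ card K))"
      by (simp add: expu sum_distrib_left mult_ac)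
    also have "(\<Sum>K\<in>Pow (- {j}). (1 / real p) ^ card K) = (1 + 1 / p) ^ (p - 1)"
      by (simp add: sum_Pow_power_card p_def Compl_eq_Diff_UNIV)
    finally show ?thesis .
  qed
  have "measure M (\<Union>j. \<Union>K\<in>Pow (- {j}). A M j K)
    \<le> (\<Sum>j\<in>UNIV. measure M (\<Union>K\<in>Pow (- {j}). A M j K))"
    using sets by (intro finite_measure_subadditive_finite) auto
  also have "\<dots> \<le> (\<Sum>j\<in>(UNIV :: 'p set). 2 * exp (- t) * (exp (- (5 / 3 * L)) * (1 + 1 / p) ^ (p - 1)))"
    by (intro sum_mono inner)
  also have "\<dots> = 2 * exp (- t) * (p * (exp (- (5 / 3 * L)) * (1 + 1 / p) ^ (p - 1)))"
    by (simp add: p_def)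
  also have "\<dots> \<le> 2 * exp (- t) * 1"
  proof (intro mult_left_mono)
    have "p * (exp (- (5 / 3 * L)) * (1 + 1 / p) ^ (p - 1))
      \<le> exp L * (exp (- (5 / 3 * L)) * exp (2 / 3 * L))"
      using one_plus_inverse_power_le[OF p2] p2
      by (intro mult_mono) (auto simp: L_def p_def)
    also have "\<dots> = 1" by (simp flip: exp_add)
    finally show "p * (exp (- (5 / 3 * L)) * (1 + 1 / p) ^ (p - 1)) \<le> 1" .
  qed simp
  finally show "measure M (\<Union>j. \<Union>K\<in>Pow (- {j}). A M j K) \<le> 2 * exp (- t)" by simp
qed

theorem theorem7p2:
  fixes M :: "'w measure"
    and X :: "'w \<Rightarrow> real^'p::finite^'n::finite"
    and Sigma0 :: "real^'p^'p"
    and alpha :: real and t :: real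
  assumes p2: "CARD('p) \<ge> 2"
    and prob: "prob_space M"
    and cov: "nonsingular_cov Sigma0"
    and rows_indep: "prob_space.indep_vars M (\<lambda>_. borel) (\<lambda>i \<omega>. X \<omega> $ i) UNIV"
    and rows_gauss: "\<And>i. distr M borel (\<lambda>\<omega>. X \<omega> $ i) = mvn Sigma0"
    and sparse: "\<And>\<pi> j. is_perm \<pi> \<Longrightarrow>
        real (s_tilde_j Sigma0 \<pi> j) \<le> alpha * real CARD('n) / ln (real CARD('p))"
    and tpos: "t > 0"
  shows "measure M {\<omega> \<in> space M. \<exists>\<pi>. is_perm \<pi> \<and>
      (\<Sum>j\<in>UNIV. ((norm_n_sq (eps_tilde Sigma0 (X \<omega>) \<pi> j) - omega_sq Sigma0 \<pi> j)
                     / omega_sq Sigma0 \<pi> j)\<^sup>2)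
      \<ge> 8 * ((real CARD('p) * t + (1 + 8 * alpha) * real (s_tilde Sigma0 \<pi>) * ln (real CARD('p))
               + 2 * real CARD('p) * ln (real CARD('p))) / real CARD('n))
        + 8 * (4 * real CARD('p) * (t\<^sup>2 + (ln (real CARD('p)))\<^sup>2) / (real CARD('n))\<^sup>2)}
    \<le> 2 * exp (- t)"
proof -
  interpret prob_space M by fact
  define L where "L = ln (real CARD('p))"
  define n where "n = real CARD('n)"
  define u where "u K = t + (card K + 5 / 3) * L" for K :: "'p set"
  define r where "r j K = axis j 1 - proj_coef Sigma0 K (axis j 1)" for j K
  define A where "A j K = {\<omega> \<in> space M. 2 * sqrt (u K / n) + 2 * (u K / n)
      \<le> \<bar>(norm_n_sq (X \<omega> *v r j K) - sig_inner Sigma0 (r j K) (r j K))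
          / sig_inner Sigma0 (r j K) (r j K)\<bar>}" for j K
  have L: "L > 0" using p2 by (simp add: L_def)
  have n: "n > 0" by (simp add: n_def)
  have sets: "(\<Union>j. \<Union>K\<in>Pow (- {j}). A j K) \<in> sets M"
    unfolding A_def u_def r_def L_def n_def
    by (rule deviation_union_bound(1)[OF p2 prob cov rows_indep rows_gauss tpos])
  have union: "measure M (\<Union>j. \<Union>K\<in>Pow (- {j}). A j K) \<le> 2 * exp (- t)"
    unfolding A_def u_def r_def L_def n_def
    by (rule deviation_union_bound(2)[OF p2 prob cov rows_indep rows_gauss tpos])
  \<comment> \<open>By contraposition: outside the union every squared error lies strictly below its
    share, with \<open>K\<close> the support and \<open>card K\<close> equal to
    \<open>s_tilde_j\<close>, and the shares add up to the threshold.\<close>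
  have key: "\<omega> \<in> (\<Union>j. \<Union>K\<in>Pow (- {j}). A j K)"
    if \<omega>: "\<omega> \<in> space M" and \<pi>: "is_perm \<pi>"
      and ge: "(\<Sum>j\<in>UNIV. ((norm_n_sq (eps_tilde Sigma0 (X \<omega>) \<pi> j) - omega_sq Sigma0 \<pi> j)
                     / omega_sq Sigma0 \<pi> j)\<^sup>2)
      \<ge> 8 * ((real CARD('p) * t + (1 + 8 * alpha) * real (s_tilde Sigma0 \<pi>) * L
               + 2 * real CARD('p) * L) / n) + 8 * (4 * real CARD('p) * (t\<^sup>2 + L\<^sup>2) / n\<^sup>2)"
    for \<omega> \<pi>
  proof (rule ccontr)
    assume notin: "\<omega> \<notin> (\<Union>j. \<Union>K\<in>Pow (- {j}). A j K)"
    define e where "e j = (norm_n_sq (eps_tilde Sigma0 (X \<omega>) \<pi> j) - omega_sq Sigma0 \<pi> j)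
      / omega_sq Sigma0 \<pi> j" for j
    define s where "s j = s_tilde_j Sigma0 \<pi> j" for j
    have less: "(e j)\<^sup>2 < 8 * ((t + (1 + 8 * alpha) * s j * L + 2 * L) / n) + 8 * (4 * (t\<^sup>2 + L\<^sup>2) / n\<^sup>2)" for j
    proof -
      define K where "K = {k. beta_tilde Sigma0 \<pi> j $ k \<noteq> 0}"
      have beta: "beta_tilde Sigma0 \<pi> j = proj_coef Sigma0 K (axis j 1)"
        unfolding K_def beta_tilde_eq_proj_coef by (rule proj_coef_support[OF cov, symmetric])
      have "K \<subseteq> later_vars \<pi> j"
        unfolding K_def beta_tilde_eq_proj_coef using proj_coef(1)[OF cov] by auto
      then have "K \<in> Pow (- {j})" using not_mem_later_vars[OF \<pi>] by auto
      then have "\<omega> \<notin> A j K" using notin by auto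
      then have "\<bar>e j\<bar> < 2 * sqrt (u K / n) + 2 * (u K / n)"
        using \<omega> by (simp add: A_def e_def eps_tilde_def omega_sq_def r_def beta not_le)
      then have "(e j)\<^sup>2 < (2 * sqrt (u K / n) + 2 * (u K / n))\<^sup>2"
        by (metis abs_ge_zero power2_abs power_strict_mono zero_less_numeral)
      also have "\<dots> \<le> 8 * ((t + (1 + 8 * alpha) * s j * L + 2 * L) / n) + 8 * (4 * (t\<^sup>2 + L\<^sup>2) / n\<^sup>2)"
        using deviation_bound[OF L tpos n, of "card K" alpha] sparse[OF \<pi>, of j]
        by (simp add: u_def s_def s_tilde_j_def K_def L_def n_def)
      finally show ?thesis .
    qed
    have "(\<Sum>j\<in>UNIV. (e j)\<^sup>2)
      < (\<Sum>j\<in>UNIV. 8 * ((t + (1 + 8 * alpha) * s j * L + 2 * L) / n) + 8 * (4 * (t\<^sup>2 + L\<^sup>2) / n\<^sup>2))"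
      by (rule sum_strict_mono) (use less in auto)
    also have "\<dots> = 8 * ((real CARD('p) * t + (1 + 8 * alpha) * real (s_tilde Sigma0 \<pi>) * L
               + 2 * real CARD('p) * L) / n) + 8 * (4 * real CARD('p) * (t\<^sup>2 + L\<^sup>2) / n\<^sup>2)"
      unfolding sum_deviation_bound s_tilde_def s_def[symmetric] ..
    finally show False using ge by (simp add: e_def)
  qed
  have "measure M {\<omega> \<in> space M. \<exists>\<pi>. is_perm \<pi> \<and>
      (\<Sum>j\<in>UNIV. ((norm_n_sq (eps_tilde Sigma0 (X \<omega>) \<pi> j) - omega_sq Sigma0 \<pi> j)
                     / omega_sq Sigma0 \<pi> j)\<^sup>2)
      \<ge> 8 * ((real CARD('p) * t + (1 + 8 * alpha) * real (s_tilde Sigma0 \<pi>) * L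
               + 2 * real CARD('p) * L) / n) + 8 * (4 * real CARD('p) * (t\<^sup>2 + L\<^sup>2) / n\<^sup>2)}
    \<le> measure M (\<Union>j. \<Union>K\<in>Pow (- {j}). A j K)"
    \<comment> \<open>Monotonicity asks for measurability of the larger set only, and that is a
      finite union; the event over all \<open>\<pi>\<close> is not itself shown measurable.\<close>
    by (rule finite_measure_mono[OF _ sets], rule subsetI, elim CollectE conjE exE, rule key)
  also note union
  finally show ?thesis by (simp only: L_def n_def)
qed

end
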